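(* Let $q$ be a prime power, let $r\ge 1$ be an integer and let $a\in\mathbb{F}_{q^2}^*$. Then $g=X^r\bigl(a+X^{q-1}\bigr)\in\mathbb{F}_{q^2}[X]$ is a permutation polynomial of $\mathbb{F}_{q^2}$ if and only if $\gcd(r,q-1)=1$, $q+1\mid r-1$, and $a^{q+1}\ne 1$.
   Context: A polynomial $g\in\mathbb{F}_{q^2}[X]$ is a permutation polynomial of $\mathbb{F}_{q^2}$ if the map $x\mapsto g(x)$ is a bijection of $\mathbb{F}_{q^2}$. *)

theory Defs
  imports
    "HOL-Computational_Algebra.Computational_Algebra"
    "HOL-Number_Theory.Prime_Powers"
    "HOL-Library.Cardinality"
begin

text \<open>The field with \<open>q\<^sup>2\<close> elements is rendered as an arbitrary field type of that cardinality.\<close>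

definition permutation_polynomial :: "'a::{field,finite} poly \<Rightarrow> bool" where
  "permutation_polynomial g \<longleftrightarrow> bij (poly g)"

end

theory Submission
  imports Defs "HOL-Number_Theory.Residues"
begin

text \<open>
  If \<open>g\<close> is a permutation, then \<open>g(x)\<^bsup>q-1\<^esup>\<close> and \<open>x\<^bsup>q-1\<^esup>\<close> have the same sum over the field,
  namely \<open>0\<close>. Since \<open>(w + a)\<^bsup>q-1\<^esup> = \<Sum>i<q. (-a)\<^bsup>q-1-i\<^esup> w\<^sup>i\<close> has no vanishing coefficient, the former
  sum is non-zero as soon as some \<open>r + i\<close> with \<open>i < q\<close> is divisible by \<open>q + 1\<close>, that is, unless
  \<open>r\<close> is \<open>1\<close> modulo \<open>q + 1\<close>. A common divisor of \<open>r\<close> and \<open>q - 1\<close> gives a nontrivial root of unity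
  \<open>z\<close> with \<open>g(z) = g(1)\<close>, and if \<open>a\<^bsup>q+1\<^esup> = 1\<close> then \<open>-a\<close> is a \<open>(q-1)\<close>-st power by Hilbert 90, so \<open>g\<close>
  has a nonzero root. Conversely, if \<open>q + 1\<close> divides \<open>r - 1\<close>, then \<open>g(x)\<^bsup>q-1\<^esup>\<close> is the image of
  \<open>u = x\<^bsup>q-1\<^esup>\<close> under the fractional linear map \<open>(a\<^sup>q u + 1) / (a + u)\<close>, which is injective when
  \<open>a\<^bsup>q+1\<^esup> \<noteq> 1\<close>; so \<open>g(x)\<close> determines both \<open>x\<^bsup>q-1\<^esup>\<close> and \<open>x\<^sup>r\<close>, whose exponents are coprime.
\<close>

section \<open>Power sums and roots of unity in finite fields\<close>

lemma power_card_minus_one_eq_one: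
  fixes x :: "'a::{field,finite}"
  assumes "x \<noteq> 0"
  shows "x ^ (CARD('a) - 1) = 1"
proof -
  have "(\<Prod>y\<in>UNIV-{0}. x * y) = (\<Prod>y\<in>UNIV-{0}. y)"
    by (rule prod.reindex_bij_witness[of _ "\<lambda>y. y / x" "\<lambda>y. x * y"]) (use assms in auto)
  moreover have "(\<Prod>y\<in>UNIV-{0}. x * y) = x ^ (CARD('a) - 1) * (\<Prod>y\<in>UNIV-{0}. y)"
    by (simp add: prod.distrib card_Diff_singleton)
  moreover have "(\<Prod>y\<in>UNIV-{0::'a}. y) \<noteq> 0"
    by simp
  ultimately show ?thesis
    by simp
qed

text \<open>\<open>X^k - 1\<close> has at most \<open>k\<close> roots, fewer than there are nonzero
  elements.\<close>

lemma ex_power_neq_one: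
  assumes "0 < k" and "k < CARD('a::{field,finite}) - 1"
  shows "\<exists>c::'a. c \<noteq> 0 \<and> c ^ k \<noteq> 1"
proof (rule ccontr)
  assume "\<not> ?thesis"
  hence all: "c ^ k = 1" if "c \<noteq> 0" for c :: 'a
    using that by blast
  let ?p = "Polynomial.monom 1 k - 1 :: 'a poly"
  have deg: "degree ?p = k"
    using assms by (intro antisym degree_diff_le le_degree) (auto simp: degree_monom_eq)
  hence "?p \<noteq> 0"
    using assms by auto
  hence "card {x. poly ?p x = 0} \<le> k"
    using card_poly_roots_bound[of ?p] deg by simp
  moreover have "UNIV - {0} \<subseteq> {x. poly ?p x = 0}"
    using all by (auto simp: poly_monom)
  hence "card (UNIV - {0::'a}) \<le> card {x. poly ?p x = 0}"
    by (intro card_mono) auto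
  ultimately show False
    using assms by (simp add: card_Diff_singleton)
qed

lemma ex_power_neq_one':
  assumes "\<not> (CARD('a::{field,finite}) - 1) dvd k"
  shows "\<exists>c::'a. c \<noteq> 0 \<and> c ^ k \<noteq> 1"
proof -
  let ?N = "CARD('a) - 1"
  have "CARD('a) > 1"
    using card_mono[of UNIV "{0, 1::'a}"] by simp
  then obtain c :: 'a where c: "c \<noteq> 0" "c ^ (k mod ?N) \<noteq> 1"
    using ex_power_neq_one[of "k mod ?N", where 'a = 'a] assms
    by (auto simp: dvd_eq_mod_eq_0)
  have "c ^ k = c ^ (?N * (k div ?N) + k mod ?N)"
    by (simp only: mult_div_mod_eq)
  also have "\<dots> = c ^ (k mod ?N)"
    by (simp only: power_add power_mult power_card_minus_one_eq_one[OF c(1)] power_one mult_1)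
  finally show ?thesis
    using c by auto
qed

text \<open>Scaling the summation variable by \<open>c\<close> multiplies the sum by
  \<open>c ^ k\<close>, which can be chosen different from 1.\<close>

lemma sum_power_eq_zero:
  assumes "\<not> (CARD('a::{field,finite}) - 1) dvd k"
  shows "(\<Sum>x::'a\<in>UNIV. x ^ k) = 0"
proof -
  obtain c :: 'a where c: "c \<noteq> 0" "c ^ k \<noteq> 1"
    using ex_power_neq_one'[OF assms] by blast
  have "(\<Sum>x::'a\<in>UNIV. x ^ k) = (\<Sum>x\<in>UNIV. (c * x) ^ k)"
    by (rule sum.reindex_bij_witness[of _ "\<lambda>x. c * x" "\<lambda>x. x / c"]) (use c in auto)
  also have "\<dots> = c ^ k * (\<Sum>x\<in>UNIV. x ^ k)"
    by (simp add: power_mult_distrib sum_distrib_left)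
  finally show ?thesis
    using c by simp
qed

lemma of_nat_card_eq_zero: "of_nat CARD('a) = (0 :: 'a::{ring_1,finite})"
  using CHAR_dvd_CARD[where 'a = 'a] by (simp add: of_nat_eq_0_iff_char_dvd)

lemma sum_power_eq_minus_one:
  assumes "(CARD('a::{field,finite}) - 1) dvd k" and "k > 0"
  shows "(\<Sum>x::'a\<in>UNIV. x ^ k) = -1"
proof -
  have "(\<Sum>x::'a\<in>UNIV. x ^ k) = (\<Sum>x::'a\<in>UNIV-{0}. x ^ k)"
    using assms(2) by (intro sum.mono_neutral_right) auto
  also have "\<dots> = (\<Sum>x::'a\<in>UNIV-{0}. 1)"
    using assms(1) by (intro sum.cong)
      (auto simp: power_mult power_card_minus_one_eq_one simp del: One_nat_def elim!: dvdE)
  also have "\<dots> = of_nat (CARD('a) - 1)"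
    by (simp add: card_Diff_singleton)
  also have "\<dots> = -1"
    by (simp add: of_nat_diff Suc_leI of_nat_card_eq_zero)
  finally show ?thesis .
qed

text \<open>Makes \<open>x \<mapsto> x ^ q\<close> an iterate of the Frobenius map, hence
  additive.\<close>

lemma primepow_card_power_imp_char_power:
  assumes "primepow q" and "CARD('a::{field,finite}) = q ^ m"
  obtains n where "prime CHAR('a)" "n > 0" "q = CHAR('a) ^ n"
proof -
  obtain p n where pn: "prime p" "n > 0" "q = p ^ n"
    using assms(1) by (auto simp: primepow_def)
  have pr: "prime CHAR('a)"
    by (intro prime_CHAR_semidom finite_imp_CHAR_pos) auto
  have "CHAR('a) dvd p ^ (n * m)"
    using CHAR_dvd_CARD[where 'a = 'a] assms(2) pn by (simp add: power_mult)
  hence "CHAR('a) = p"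
    using pr pn(1) by (metis prime_dvd_power primes_dvd_imp_eq)
  thus ?thesis
    using that pr pn by simp
qed

lemma power_eq_one_coprime:
  fixes z :: "'a::field"
  assumes "z ^ m = 1" and "z ^ n = 1" and "gcd m n = 1" and "m > 0"
  shows "z = 1"
proof -
  obtain x y where xy: "m * x = n * y + 1"
    using bezout_nat[of m n] assms by auto
  have "1 = z ^ (m * x)"
    by (simp only: power_mult assms power_one)
  also have "\<dots> = z"
    unfolding xy by (simp add: power_add power_mult assms)
  finally show ?thesis ..
qed

section \<open>Frobenius and the norm \<open>x ^ (q + 1)\<close> in the field of
  \<open>q ^ 2\<close> elements\<close>

context
  fixes q :: nat
  assumes q: "primepow q" and card: "CARD('a::{field,finite}) = q ^ 2"
begin

lemma q_gt_1: "q > 1"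
  using primepow_gt_Suc_0[OF q] by simp

lemma card_minus_one: "CARD('a) - 1 = (q - 1) * (q + 1)"
  using q_gt_1 by (simp add: card power2_eq_square algebra_simps)

lemma q_less_card: "q < CARD('a)"
  using q_gt_1 by (simp add: card power2_eq_square)

lemma frobenius_add: "(x + y :: 'a) ^ q = x ^ q + y ^ q"
  using primepow_card_power_imp_char_power[OF q card] freshmans_dream' by metis

lemma frobenius_diff: "(x - y :: 'a) ^ q = x ^ q - y ^ q"
  using frobenius_add[of "x - y" y] by (simp add: algebra_simps)

lemma of_nat_q: "of_nat q = (0 :: 'a)"
proof -
  have "of_nat (q ^ 2) = (0 :: 'a)"
    using of_nat_card_eq_zero[where 'a = 'a] by (simp add: card)
  thus ?thesis
    by simp
qed

lemma frobenius_twice: "((x :: 'a) ^ q) ^ q = x"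
proof (cases "x = 0")
  case False
  have "(x ^ q) ^ q = x ^ (CARD('a) - 1) * x"
    using q_gt_1 by (simp flip: power_mult power_Suc2 add: card power2_eq_square)
  thus ?thesis
    using power_card_minus_one_eq_one[OF False] by simp
qed (use q_gt_1 in simp)

lemma norm_power_q_minus_one:
  assumes "(x :: 'a) \<noteq> 0"
  shows "(x ^ (q - 1)) ^ (q + 1) = 1"
  using power_card_minus_one_eq_one[OF assms] by (simp only: card_minus_one power_mult)

lemma minus_power_q_plus_one: "(- x :: 'a) ^ (q + 1) = x ^ (q + 1)"
  using frobenius_diff[of 0 x] q_gt_1 by (simp add: power_0_left)

text \<open>Divide \<open>(w - b) ^ q = w ^ q - b ^ q\<close> by \<open>w - b\<close>. At
  \<open>w = b\<close> the sum consists of \<open>q\<close> equal terms and vanishes in this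
  characteristic.\<close>

lemma power_q_minus_one_eq_sum:
  "(w - b :: 'a) ^ (q - 1) = (\<Sum>i<q. b ^ (q - Suc i) * w ^ i)"
proof (cases "w = b")
  case True
  have "(\<Sum>i<q. b ^ (q - Suc i) * b ^ i) = (\<Sum>i<q. b ^ (q - 1))"
    by (intro sum.cong) (auto simp flip: power_add)
  also have "\<dots> = 0"
    by (simp add: of_nat_q)
  finally show ?thesis
    using True q_gt_1 by simp
next
  case False
  have "(w - b) * (w - b) ^ (q - 1) = (w - b) ^ q"
    using q_gt_1 by (simp flip: power_Suc)
  also have "\<dots> = (w - b) * (\<Sum>i<q. b ^ (q - Suc i) * w ^ i)"
    by (simp only: frobenius_diff power_diff_sumr2)
  finally show ?thesis
    using False by simp
qed

section \<open>A power sum of the binomial\<close>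

lemma sum_power_binomial_neq_zero:
  fixes b :: 'a
  assumes "b \<noteq> 0" and "r \<ge> 1" and "\<not> (q + 1) dvd (r - 1)"
  shows "(\<Sum>x\<in>UNIV. (x ^ r * (x ^ (q - 1) - b)) ^ (q - 1)) \<noteq> 0"
proof -
  let ?N = "CARD('a) - 1"
  have dvd_iff: "?N dvd (q - 1) * (r + i) \<longleftrightarrow> (q + 1) dvd (r + i)" for i
    using q_gt_1 unfolding card_minus_one by (subst nat_mult_dvd_cancel_disj) auto
  \<comment> \<open>Exactly one of \<open>r, ..., r + q\<close> is a multiple of
    \<open>q + 1\<close>. It is not \<open>r + q\<close>, as \<open>q + 1\<close> does not divide
    \<open>r - 1\<close>; hence it is \<open>r + j\<close> with \<open>j < q\<close>, and only this
    term of the expansion survives summation.\<close>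
  define j where "j = q - (r - 1) mod (q + 1)"
  have "(r - 1) mod (q + 1) \<noteq> 0" "(r - 1) mod (q + 1) \<le> q"
    using assms(3) mod_less_divisor[of "q + 1" "r - 1"] by (auto simp: dvd_eq_mod_eq_0)
  hence j: "j < q" "r + j = (q + 1) + (r - 1) div (q + 1) * (q + 1)"
    using div_mult_mod_eq[of "r - 1" "q + 1"] assms(2) q_gt_1 unfolding j_def by linarith+
  have j_dvd: "(q + 1) dvd (r + j)"
    unfolding j(2) by (rule dvd_add[OF dvd_refl dvd_triv_right])
  have j_unique: "i = j" if "i < q" "(q + 1) dvd (r + i)" for i
  proof -
    have "(r + i) mod (q + 1) = (r + j) mod (q + 1)"
      using that j_dvd by (simp add: dvd_eq_mod_eq_0)
    hence "[i = j] (mod (q + 1))"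
      by (simp add: cong_def[symmetric] cong_add_lcancel_nat)
    thus ?thesis
      using that j by (simp add: cong_less_modulus_unique_nat)
  qed
  have "(\<Sum>x\<in>UNIV. (x ^ r * (x ^ (q - 1) - b)) ^ (q - 1))
      = (\<Sum>x\<in>UNIV. \<Sum>i<q. b ^ (q - Suc i) * x ^ ((q - 1) * (r + i)))"
  proof (intro sum.cong refl)
    fix x :: 'a
    have "(x ^ r * (x ^ (q - 1) - b)) ^ (q - 1)
        = x ^ ((q - 1) * r) * (\<Sum>i<q. b ^ (q - Suc i) * x ^ ((q - 1) * i))"
      by (simp only: power_mult_distrib power_q_minus_one_eq_sum mult.commute[of _ r]
          flip: power_mult)
    thus "(x ^ r * (x ^ (q - 1) - b)) ^ (q - 1)
        = (\<Sum>i<q. b ^ (q - Suc i) * x ^ ((q - 1) * (r + i)))"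
      by (simp only: sum_distrib_left distrib_left power_add mult.left_commute)
  qed
  also have "\<dots> = (\<Sum>i<q. b ^ (q - Suc i) * (\<Sum>x\<in>UNIV. x ^ ((q - 1) * (r + i))))"
    by (subst sum.swap) (simp add: sum_distrib_left)
  also have "\<dots> = (\<Sum>i<q. if i = j then - (b ^ (q - Suc j)) else 0)"
  proof (intro sum.cong refl)
    fix i assume i: "i \<in> {..<q}"
    show "b ^ (q - Suc i) * (\<Sum>x\<in>UNIV. x ^ ((q - 1) * (r + i)))
        = (if i = j then - (b ^ (q - Suc j)) else 0)"
    proof (cases "i = j")
      case True
      have "(\<Sum>x::'a\<in>UNIV. x ^ ((q - 1) * (r + j))) = -1"
        by (rule sum_power_eq_minus_one) (use dvd_iff j_dvd assms(2) q_gt_1 in auto)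
      thus ?thesis
        using True by simp
    next
      case False
      have "(\<Sum>x::'a\<in>UNIV. x ^ ((q - 1) * (r + i))) = 0"
        by (rule sum_power_eq_zero) (use dvd_iff j_unique i False in auto)
      thus ?thesis
        using False by simp
    qed
  qed
  also have "\<dots> = - (b ^ (q - Suc j))"
    using j by simp
  finally show ?thesis
    using assms(1) by simp
qed

section \<open>Necessity of the three conditions\<close>

lemma hilbert90:
  fixes a :: 'a
  assumes "a ^ (q + 1) = 1"
  obtains x where "x \<noteq> 0" "x ^ (q - 1) = - a"
proof -
  have a: "a \<noteq> 0" "a * a ^ q = 1"
    using assms by auto
  \<comment> \<open>This choice of \<open>c\<close> keeps the resolvent \<open>x\<close> below from
    vanishing.\<close>
  obtain c where c: "c \<noteq> 0" "c ^ (q - 1) \<noteq> a"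
  proof (cases "a = 1")
    case True
    have "0 < q - 1" "q - 1 < CARD('a) - 1"
      using q_gt_1 q_less_card by linarith+
    thus ?thesis
      using ex_power_neq_one[where 'a = 'a] True that by blast
  qed (use that[of 1] in auto)
  \<comment> \<open>A Lagrange resolvent: since \<open>a ^ q = 1 / a\<close>, Frobenius sends it to
    \<open>c ^ q - a * c = - a * x\<close>.\<close>
  define x where "x = c - c ^ q / a"
  have pow_q: "y ^ q = y * y ^ (q - 1)" for y :: 'a
    using q_gt_1 by (simp flip: power_Suc)
  have "x = c * (a - c ^ (q - 1)) / a"
    using a by (simp add: x_def pow_q[of c] field_simps)
  hence x: "x \<noteq> 0"
    using c a by simp
  have "x ^ q = c ^ q - c / a ^ q"
    by (simp add: x_def frobenius_diff power_divide frobenius_twice)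
  also have "c / a ^ q = a * c"
    using a by (simp add: field_simps)
  also have "c ^ q - a * c = x * (- a)"
    using a by (simp add: x_def field_simps)
  finally have "x ^ (q - 1) = - a"
    using x unfolding pow_q[of x] by (simp only: mult_cancel_left) simp
  thus ?thesis
    using that x by blast
qed

lemma inj_imp_norm_neq_one:
  fixes a :: 'a
  assumes "inj (\<lambda>x. x ^ r * (a + x ^ (q - 1)))" and "r \<ge> 1"
  shows "a ^ (q + 1) \<noteq> 1"
proof
  assume "a ^ (q + 1) = 1"
  then obtain x where x: "x \<noteq> 0" "x ^ (q - 1) = - a"
    using hilbert90 by blast
  have "x = 0"
    by (rule injD[OF assms(1)]) (use x assms(2) in simp)
  thus False
    using x by simp
qed

lemma inj_imp_coprime:
  fixes a :: 'a
  assumes "inj (\<lambda>x. x ^ r * (a + x ^ (q - 1)))"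
  shows "gcd r (q - 1) = 1"
proof (rule ccontr)
  define d where "d = gcd r (q - 1)"
  assume "gcd r (q - 1) \<noteq> 1"
  hence d: "d > 1"
    using q_gt_1 by (simp add: d_def nat_neq_iff)
  obtain m where m: "CARD('a) - 1 = d * m"
    by (metis card_minus_one d_def dvdE dvd_mult2 gcd_dvd2)
  have "m > 0"
    using m q_gt_1 q_less_card by (intro Nat.gr0I) auto
  moreover have "m < CARD('a) - 1"
    unfolding m using d \<open>m > 0\<close> by simp
  ultimately obtain c :: 'a where c: "c \<noteq> 0" "c ^ m \<noteq> 1"
    using ex_power_neq_one by blast
  \<comment> \<open>A \<open>d\<close>-th root of unity other than 1. As \<open>d\<close> divides
    both \<open>r\<close> and \<open>q - 1\<close>, the binomial takes the same value at
    \<open>z\<close> and at 1.\<close>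
  define z where "z = c ^ m"
  have "z ^ d = 1"
    using power_card_minus_one_eq_one[OF c(1)] unfolding z_def m by (metis mult.commute power_mult)
  hence "z ^ k = 1" if "d dvd k" for k
    using that by (auto simp: power_mult elim!: dvdE)
  hence "z ^ r = 1" "z ^ (q - 1) = 1"
    by (auto simp: d_def)
  have "z = 1"
    by (rule injD[OF assms]) (simp add: \<open>z ^ r = 1\<close> \<open>z ^ (q - 1) = 1\<close> del: One_nat_def)
  thus False
    using c by (simp add: z_def)
qed

lemma bij_imp_dvd:
  fixes a :: 'a
  assumes "bij (\<lambda>x. x ^ r * (a + x ^ (q - 1)))" and "r \<ge> 1" and "a \<noteq> 0"
  shows "(q + 1) dvd (r - 1)"
proof (rule ccontr)
  assume "\<not> ?thesis"
  hence "(\<Sum>x\<in>UNIV. (x ^ r * (x ^ (q - 1) - (- a))) ^ (q - 1)) \<noteq> 0"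
    using assms by (intro sum_power_binomial_neq_zero) auto
  moreover have "(\<Sum>x\<in>UNIV. (x ^ r * (a + x ^ (q - 1))) ^ (q - 1)) = (\<Sum>x::'a\<in>UNIV. x ^ (q - 1))"
    by (rule sum.reindex_bij_betw[OF assms(1)])
  \<comment> \<open>Here \<open>0 < q - 1 < q ^ 2 - 1\<close>, so the exponent is not a multiple of
    the group order.\<close>
  moreover have "\<dots> = 0"
    using q_gt_1 q_less_card by (intro sum_power_eq_zero nat_dvd_not_less) auto
  ultimately show False
    by (simp add: add.commute)
qed

section \<open>Sufficiency of the three conditions\<close>

lemma inj_binomial:
  fixes a :: 'a
  assumes "gcd r (q - 1) = 1" and "(q + 1) dvd (r - 1)" and "a ^ (q + 1) \<noteq> 1" and "r \<ge> 1"
  shows "inj (\<lambda>x. x ^ r * (a + x ^ (q - 1)))"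
proof (rule injI)
  let ?g = "\<lambda>x. x ^ r * (a + x ^ (q - 1))"
  fix x y :: 'a
  assume eq: "?g x = ?g y"
  \<comment> \<open>Otherwise \<open>a\<close> would be minus a \<open>(q - 1)\<close>-st power and
    so have norm 1.\<close>
  have nz: "a + x ^ (q - 1) \<noteq> 0" if "x \<noteq> 0" for x :: 'a
  proof
    assume "a + x ^ (q - 1) = 0"
    hence "a = - (x ^ (q - 1))"
      by (simp add: eq_neg_iff_add_eq_0)
    thus False
      using norm_power_q_minus_one[OF that] minus_power_q_plus_one[of "x ^ (q - 1)"] assms(3) by simp
  qed
  show "x = y"
  proof (cases "x = 0 \<or> y = 0")
    case True
    thus ?thesis
    proof
      assume "x = 0"
      hence "?g y = 0"
        using eq assms(4) by (simp add: power_0_left)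
      thus ?thesis
        using \<open>x = 0\<close> nz[of y] by auto
    next
      assume "y = 0"
      hence "?g x = 0"
        using eq assms(4) by (simp add: power_0_left)
      thus ?thesis
        using \<open>y = 0\<close> nz[of x] by auto
    qed
  next
    case False
    \<comment> \<open>The fractional linear map with its denominator cleared. With
      \<open>u = x ^ (q - 1)\<close> it rests on \<open>u ^ r = u\<close>, as \<open>r\<close> is 1
      modulo \<open>q + 1\<close>, and on \<open>u * u ^ q = 1\<close>.\<close>
    have quot: "?g x ^ (q - 1) * (a + x ^ (q - 1)) = a ^ q * x ^ (q - 1) + 1" if "x \<noteq> 0" for x :: 'a
    proof -
      define u where "u = x ^ (q - 1)"
      have u: "u ^ (q + 1) = 1"
        unfolding u_def by (rule norm_power_q_minus_one[OF that])
      obtain k where k: "r = (q + 1) * k + 1"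
        using assms(2,4) by (metis dvdE le_add_diff_inverse2)
      hence "u ^ r = u"
        unfolding k power_add[of u "(q + 1) * k"] power_mult[of u "q + 1"] u by simp
      have "?g x ^ (q - 1) * (a + u) = (x ^ r) ^ (q - 1) * ((a + u) ^ (q - 1) * (a + u))"
        by (simp add: u_def power_mult_distrib mult.assoc)
      also have "(x ^ r) ^ (q - 1) = u"
        using \<open>u ^ r = u\<close> by (simp add: u_def mult.commute flip: power_mult)
      also have "(a + u) ^ (q - 1) * (a + u) = a ^ q + u ^ q"
        using q_gt_1 by (simp flip: power_Suc2 frobenius_add)
      also have "u * (a ^ q + u ^ q) = a ^ q * u + 1"
        using u by (simp add: algebra_simps)
      finally show ?thesis
        by (simp add: u_def)
    qed
    define u v where "u = x ^ (q - 1)" and "v = y ^ (q - 1)"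
    define G where "G = ?g x ^ (q - 1)"
    have "G * (a + u) = a ^ q * u + 1" "G * (a + v) = a ^ q * v + 1"
      using quot[of x] quot[of y] False eq by (simp_all add: G_def u_def v_def)
    hence "(a ^ q * u + 1) * (a + v) = (a ^ q * v + 1) * (a + u)"
      by (metis mult.assoc mult.commute)
    \<comment> \<open>The first factor is the determinant of the fractional linear map.\<close>
    hence "(a ^ (q + 1) - 1) * (u - v) = 0"
      by (simp add: algebra_simps)
    hence "u = v"
      using assms(3) by simp
    \<comment> \<open>The factors \<open>a + u\<close> and \<open>a + v\<close> now agree and are
      nonzero, so they cancel.\<close>
    hence "x ^ r = y ^ r"
      using eq nz[of x] False by (simp add: u_def v_def)
    hence "(x / y) ^ r = 1" "(x / y) ^ (q - 1) = 1"
      using False \<open>u = v\<close> by (simp_all add: u_def v_def power_divide)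
    hence "x / y = 1"
      using power_eq_one_coprime assms(1,4) by (metis less_le_trans zero_less_one)
    thus ?thesis
      using False by simp
  qed
qed

end

theorem theorem4p2:
  fixes q r :: nat and a :: "'a::{field,finite}"
  assumes "primepow q" and "CARD('a) = q ^ 2" and "r \<ge> 1" and "a \<noteq> 0"
  shows "permutation_polynomial (Polynomial.monom 1 r * ([:a:] + Polynomial.monom 1 (q - 1))) \<longleftrightarrow>
    gcd r (q - 1) = 1 \<and> (q + 1) dvd (r - 1) \<and> a ^ (q + 1) \<noteq> 1"
proof -
  let ?g = "\<lambda>x. x ^ r * (a + x ^ (q - 1))"
  have "poly (Polynomial.monom 1 r * ([:a:] + Polynomial.monom 1 (q - 1))) = ?g"
    by (simp add: fun_eq_iff poly_monom)
  moreover have "bij ?g \<longleftrightarrow> inj ?g"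
    using finite_UNIV_inj_surj[of ?g] by (auto simp: bij_def)
  ultimately show ?thesis
    using inj_imp_coprime[OF assms(1,2)] bij_imp_dvd[OF assms(1,2) _ assms(3,4)]
      inj_imp_norm_neq_one[OF assms(1,2) _ assms(3)] inj_binomial[OF assms(1,2) _ _ _ assms(3)]
    unfolding permutation_polynomial_def by auto
qed

end
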